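(* Let $n$ be a positive integer. Every $x \in V_{B_n}$ is the root of a reversed binary tree (in the graph of $\theta$ on $\mathbf{P}^1(\mathbf{F}_{5^n})$), of depth $d$, with the following properties. - There are $2^{k-1}$ vertices at any level $k$ of the tree with $0 < k \le d$. Moreover, the root has one child, while all other vertices at levels smaller than $d$ have two children. - The depth of the tree is $d = 2$ if $n$ is even and $d = 3$ if $n$ is odd.
   Context: Let $\mathbf{P}^1(\mathbf{F}_{5^n}) = \mathbf{F}_{5^n} \cup \{\infty\}$ and let $\theta(x) = x + x^{-1}$ for $x \neq 0,\infty$, $\theta(0)=\theta(\infty)=\infty$. The graph of $\theta$ has vertex set $\mathbf{P}^1(\mathbf{F}_{5^n})$ and a directed edge from $\alpha$ to $\theta(\alpha)$ for each $\alpha$. An element $\gamma$ is periodic (belongs to a cycle) if $\theta^k(\gamma)=\gamma$ for some positive integer $k$. Let $E$ be the elliptic curve $y^2=x^3+x$ over $\mathbf{F}_5$. Let $B_n' = \{x \in \mathbf{F}_{5^n} : (x,y) \in E(\mathbf{F}_{5^{2n}}) \text{ for some } y \in \mathbf{F}_{5^{2n}}\setminus\mathbf{F}_{5^n}\}$; set $B_n = B_n'\setminus\{1,-1\}$ if $n$ is odd and $B_n = B_n'$ if $n$ is even. The map $\theta$ sends $B_n$ to itself. $V_{B_n}$ denotes the set of elements of $\mathbf{F}_{5^n}$ belonging to some cycle formed by elements of $B_n$. For periodic $x$, the reversed tree rooted in $x$ has $x$ as its only vertex at level $0$; an element $\tilde x \in \mathbf{P}^1(\mathbf{F}_{5^n})$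 is at level $k>0$ if $\theta^k(\tilde x)=x$ and none of $\theta^i(\tilde x)$ with $0\le i<k$ is periodic. The children of a vertex $z$ of the tree at level $k$ are the vertices $\tilde z$ at level $k+1$ with $\theta(\tilde z)=z$. The depth of the tree is the largest level that contains a vertex. *)

theory Defs
  imports Main "HOL-Library.Cardinality"
begin

text \<open>The projective line over a field \<open>'a\<close> is \<open>'a option\<close>, with \<open>None\<close> as the point at infinity.\<close>

fun theta :: "'a::field option \<Rightarrow> 'a option" where
  "theta None = None"
| "theta (Some x) = (if x = 0 then None else Some (x + inverse x))"

definition graph_arcs :: "('v \<Rightarrow> 'v) \<Rightarrow> ('v \<times> 'v) set" where
  "graph_arcs f = {(a, f a) | a. True}"

definition periodic :: "('v \<Rightarrow> 'v) \<Rightarrow> 'v \<Rightarrow> bool" where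
  "periodic f x \<longleftrightarrow> (\<exists>k>0. (f ^^ k) x = x)"

text \<open>For \<open>k = 0\<close> the condition on the iterates is void and the level is \<open>{x}\<close>.\<close>

definition tree_level :: "('v \<Rightarrow> 'v) \<Rightarrow> 'v \<Rightarrow> nat \<Rightarrow> 'v set" where
  "tree_level f x k = {y. (f ^^ k) y = x \<and> (\<forall>i<k. \<not> periodic f ((f ^^ i) y))}"

text \<open>The children of a vertex \<open>z\<close> lying at level \<open>k\<close>.\<close>

definition tree_children :: "('v \<Rightarrow> 'v) \<Rightarrow> 'v \<Rightarrow> nat \<Rightarrow> 'v \<Rightarrow> 'v set" where
  "tree_children f x k z = {y \<in> tree_level f x (Suc k). f y = z}"

definition tree_verts :: "('v \<Rightarrow> 'v) \<Rightarrow> 'v \<Rightarrow> 'v set" where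
  "tree_verts f x = (\<Union>k. tree_level f x k)"

definition tree_arcs :: "('v \<Rightarrow> 'v) \<Rightarrow> 'v \<Rightarrow> ('v \<times> 'v) set" where
  "tree_arcs f x = {(y, z). \<exists>k. z \<in> tree_level f x k \<and> y \<in> tree_children f x k z}"

definition tree_has_depth :: "('v \<Rightarrow> 'v) \<Rightarrow> 'v \<Rightarrow> nat \<Rightarrow> bool" where
  "tree_has_depth f x d \<longleftrightarrow>
     tree_level f x d \<noteq> {} \<and> (\<forall>k. tree_level f x k \<noteq> {} \<longrightarrow> k \<le> d)"

text \<open>
  A rooted tree with all arcs directed towards the root \<open>r\<close> in which every vertex has at most
  two children. Acyclicity follows from the unique outgoing arcs and the reachability of \<open>r\<close>.
\<close>

definition reversed_binary_tree :: "'v set \<Rightarrow> ('v \<times> 'v) set \<Rightarrow> 'v \<Rightarrow> bool" where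
  "reversed_binary_tree V A r \<longleftrightarrow>
     r \<in> V \<and> A \<subseteq> V \<times> V \<and>
     (\<forall>z. (r, z) \<notin> A) \<and>
     (\<forall>y \<in> V - {r}. \<exists>!z. (y, z) \<in> A) \<and>
     (\<forall>y \<in> V. (y, r) \<in> A\<^sup>*) \<and>
     (\<forall>z \<in> V. finite {y. (y, z) \<in> A} \<and> card {y. (y, z) \<in> A} \<le> 2)"

text \<open>The points over \<open>'a\<close> of \<open>y\<^sup>2 = x\<^sup>3 + x\<close>, with \<open>None\<close> as the point at infinity.\<close>

definition E_points :: "('a::field \<times> 'a) option set" where
  "E_points = insert None (Some ` {(x, y). y ^ 2 = x ^ 3 + x})"

definition field_embedding :: "('a::field \<Rightarrow> 'b::field) \<Rightarrow> bool" where
  "field_embedding \<iota> \<longleftrightarrow>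
     \<iota> 1 = 1 \<and> (\<forall>x y. \<iota> (x + y) = \<iota> x + \<iota> y) \<and> (\<forall>x y. \<iota> (x * y) = \<iota> x * \<iota> y)"

text \<open>
  In what follows \<open>'a\<close> is the field with \<open>5 ^ n\<close> elements, \<open>'b\<close> the field with \<open>5 ^ (2 * n)\<close>
  elements, and \<open>'a\<close> is regarded as the subfield \<open>range \<iota>\<close> of \<open>'b\<close>.
\<close>

definition B' :: "('a::field \<Rightarrow> 'b::field) \<Rightarrow> 'a set" where
  "B' \<iota> = {x. \<exists>y. y \<notin> range \<iota> \<and> Some (\<iota> x, y) \<in> E_points}"

definition B :: "nat \<Rightarrow> ('a::field \<Rightarrow> 'b::field) \<Rightarrow> 'a set" where
  "B n \<iota> = (if odd n then B' \<iota> - {1, -1} else B' \<iota>)"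

definition V_B :: "nat \<Rightarrow> ('a::field \<Rightarrow> 'b::field) \<Rightarrow> 'a set" where
  "V_B n \<iota> = {x. periodic theta (Some x) \<and> (\<forall>i. (theta ^^ i) (Some x) \<in> Some ` B n \<iota>)}"

end

theory Submission
  imports Defs "HOL-Computational_Algebra.Nth_Powers" "HOL-Computational_Algebra.Polynomial"
begin

text \<open>
  Everything is governed by which elements of the field are squares. Write \<open>K\<close> for the field with
  \<open>5 ^ n\<close> elements and \<open>\<theta>(t) = t + 1 / t\<close>. Since \<open>t\<^sup>3 + t = t\<^sup>2 \<theta>(t)\<close>, an abscissa \<open>t\<close> whose
  ordinates lie outside \<open>K\<close> is one for which \<open>\<theta>(t)\<close> is a nonsquare in \<open>K\<close>. On a cycle of such
  elements, each one is also the image of its predecessor and is therefore a nonsquare itself.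

  Let \<open>\<theta>(z)\<close> be a nonsquare. The equation \<open>\<theta>(t) = z\<close> is quadratic with discriminant
  \<open>z\<^sup>2 - 4 = z\<^sup>2 + 1 = z \<theta>(z)\<close>, because \<open>5 = 0\<close>, so \<open>z\<close> has two preimages, \<open>t\<close> and \<open>1 / t\<close>, if \<open>z\<close>
  is a nonsquare (lemma \<open>card_theta_fibre_eq_2\<close>) and none if \<open>z\<close> is a square
  (lemma \<open>theta_fibre_empty\<close>). A vertex of the tree whose parent is a nonsquare thus branches
  exactly when it is a nonsquare.

  Now let \<open>q \<mapsto> w \<mapsto> p \<mapsto> x\<close> be consecutive elements of the cycle. The only child of \<open>x\<close> outside the
  cycle is \<open>1 / p\<close>, a nonsquare, which has two children. With \<open>m = 2 (w + 2) / (w - 2)\<close> they are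
  \<open>m\<close> and \<open>1 / m\<close> (lemma \<open>shift_plus_inverse\<close>), and they have the quadratic character of \<open>2\<close>
  (lemma \<open>is_square_shift_iff\<close>). If \<open>n\<close> is even, \<open>2\<close> is a square and the tree stops at level \<open>2\<close>.
  If \<open>n\<close> is odd, \<open>2\<close> is a nonsquare, so \<open>m\<close> and \<open>1 / m\<close> branch; a computation that goes back to
  \<open>q\<close> shows that their four children are squares (lemma \<open>is_square_theta_preimage_shift\<close>), and
  the tree stops at level \<open>3\<close>.

  The two facts about finite fields that enter, that a product of two nonsquares is a square and
  that \<open>2\<close> is a square exactly for even \<open>n\<close>, both come from the Euler criterion.
\<close>

section \<open>Squares in finite fields\<close>

lemma finite_field_power_card_minus_1:
  fixes x :: "'a::{field,finite}"
  assumes "x \<noteq> 0"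
  shows "x ^ (CARD('a) - 1) = 1"
proof -
  have "bij_betw ((*) x) (- {0}) (- {0})"
    using assms by (intro bij_betw_byWitness[where f' = "\<lambda>y. y / x"]) auto
  then have "(\<Prod>y\<in>- {0}. x * y) = (\<Prod>y\<in>- {0}. y)"
    by (rule prod.reindex_bij_betw)
  then show ?thesis
    by (simp add: prod.distrib Compl_eq_Diff_UNIV card_Diff_singleton)
qed

text \<open>
  Squaring is two-to-one on the units, so half of the units are squares. Each of them is a root
  of \<open>X ^ h - 1\<close>, where \<open>h\<close> is their number, and that polynomial has no room for further roots.
\<close>

lemma euler_criterion_finite_field:
  fixes a :: "'a::{field,finite}"
  assumes two: "(2::'a) \<noteq> 0" and "a \<noteq> 0"
  shows "is_square a \<longleftrightarrow> a ^ ((CARD('a) - 1) div 2) = 1"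
proof -
  define T where "T = (\<lambda>x::'a. x ^ 2) ` (- {0})"
  define h where "h = card T"
  have fibre: "card {x \<in> - {0}. x ^ 2 = s} = 2" if s: "s \<in> T" for s
  proof -
    obtain x where x: "x \<noteq> 0" "s = x ^ 2"
      using s by (auto simp: T_def)
    have "{x \<in> - {0}. x ^ 2 = s} = {x, - x}"
      using x by (auto simp: power2_eq_iff)
    moreover have "x \<noteq> - x"
    proof
      assume "x = - x"
      then have "2 * x = 0"
        by (simp add: eq_neg_iff_add_eq_0 flip: mult_2)
      with two x show False by simp
    qed
    ultimately show ?thesis by simp
  qed
  have "(\<Sum>x\<in>- {0}. card {s \<in> T. x ^ 2 = s}) = 2 * card T"
    by (rule sum_multicount) (use fibre in auto)
  moreover have "card {s \<in> T. x ^ 2 = s} = 1" if "x \<in> - {0}" for x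
  proof -
    have "{s \<in> T. x ^ 2 = s} = {x ^ 2}"
      using that by (auto simp: T_def)
    then show ?thesis by simp
  qed
  ultimately have "card (- {0::'a}) = 2 * h"
    by (simp add: h_def)
  then have card: "CARD('a) - 1 = 2 * h"
    by (simp add: Compl_eq_Diff_UNIV card_Diff_singleton)
  define P where "P = monom (1::'a) h - 1"
  have "1 \<in> T"
    by (auto simp: T_def intro!: image_eqI[of _ _ 1])
  then have "h > 0"
    by (auto simp: h_def card_gt_0_iff)
  then have "coeff P h = 1"
    by (simp add: P_def)
  then have "P \<noteq> 0" by auto
  moreover have "degree P \<le> h"
    by (auto simp: P_def intro!: degree_diff_le degree_monom_le)
  moreover have "{x. poly P x = 0} = {x. x ^ h = 1}"
    by (auto simp: P_def poly_monom)
  ultimately have "card {x::'a. x ^ h = 1} \<le> card T"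
    using card_poly_roots_bound[of P] by (simp add: h_def)
  moreover have "(x ^ 2) ^ h = 1" if "x \<noteq> 0" for x :: 'a
    using finite_field_power_card_minus_1[OF that] card by (metis power_mult)
  then have "T \<subseteq> {x. x ^ h = 1}"
    by (auto simp: T_def)
  ultimately have "T = {x. x ^ h = 1}"
    by (intro card_seteq) auto
  moreover have "is_square a \<longleftrightarrow> a \<in> T"
    using \<open>a \<noteq> 0\<close> by (auto simp: T_def is_nth_power_def)
  ultimately show ?thesis
    unfolding card by simp
qed

text \<open>By the Euler criterion, raising to the power \<open>(q - 1) / 2\<close>, where \<open>q\<close> is the order of the
  field, maps both factors to \<open>- 1\<close> and hence the product to \<open>1\<close>.\<close>

lemma is_square_mult_nonsquares:
  fixes a b :: "'a::{field,finite}"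
  assumes two: "(2::'a) \<noteq> 0" and a: "\<not> is_square a" and b: "\<not> is_square b"
  shows "is_square (a * b)"
proof -
  define h where "h = (CARD('a) - 1) div 2"
  have minus_one: "c ^ h = - 1" if c: "\<not> is_square c" for c :: 'a
  proof -
    have "c \<noteq> 0"
      using c by auto
    then have "is_square (c ^ 2)" "c ^ 2 \<noteq> 0"
      by auto
    then have "(c ^ h) ^ 2 = 1"
      using euler_criterion_finite_field[OF two, of "c ^ 2"]
      by (simp add: h_def mult.commute flip: power_mult)
    moreover have "c ^ h \<noteq> 1"
      using euler_criterion_finite_field[OF two \<open>c \<noteq> 0\<close>] c by (simp add: h_def)
    ultimately show ?thesis
      by (simp add: power2_eq_1_iff)
  qed
  have "(a * b) ^ h = 1"
    using minus_one a b by (simp add: power_mult_distrib)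
  moreover have "a * b \<noteq> 0"
    using a b by auto
  ultimately show ?thesis
    using euler_criterion_finite_field[OF two] by (simp add: h_def)
qed

text \<open>The form in which square classes are compared below: two elements whose product is a
  nonzero square are both squares or both nonsquares.\<close>

lemma is_square_cong:
  fixes a b c :: "'a::field"
  assumes "a * b = c ^ 2" "c \<noteq> 0"
  shows "is_square a \<longleftrightarrow> is_square b"
proof -
  have *: "is_square b" if sq: "is_square a" "a * b = c ^ 2" for a b :: 'a
  proof -
    obtain d where d: "a = d ^ 2"
      using sq by (auto elim: is_nth_powerE)
    with sq assms have "d \<noteq> 0" by auto
    with sq(2) have "b = (c / d) ^ 2"
      by (simp add: d power_divide eq_divide_eq mult.commute)
    then show ?thesis by (auto intro: is_nth_powerI)
  qed
  show ?thesis
    using *[of a b] *[of b a] assms by (auto simp: mult.commute)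
qed

lemma is_square_inverse_iff [simp]:
  fixes a :: "'a::field"
  shows "is_square (inverse a) \<longleftrightarrow> is_square a"
proof (cases "a = 0")
  case False
  then show ?thesis
    by (intro is_square_cong[of _ _ 1]) auto
qed auto

lemma five_eq_0:
  assumes "CARD('a::{field,finite}) = 5 ^ n"
  shows "(5::'a) = 0"
proof -
  have "of_nat (5 ^ n) = (0::'a)"
  proof -
    \<comment> \<open>Translation by \<open>1\<close> preserves the sum of all elements but adds the cardinality to it.\<close>
    have "bij ((+) (1::'a))"
      by (rule bij_betw_byWitness[where f' = "\<lambda>x. x - 1"]) auto
    then have "(\<Sum>x\<in>UNIV. 1 + x) = (\<Sum>x\<in>UNIV. x :: 'a)"
      by (rule sum.reindex_bij_betw)
    then show ?thesis
      by (simp add: sum.distrib assms)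
  qed
  then show ?thesis by (cases "n = 0") auto
qed

lemma two_neq_0:
  assumes "(5::'a::field) = 0"
  shows "(2::'a) \<noteq> 0"
proof
  assume "(2::'a) = 0"
  moreover have "(1::'a) = 5 - 2 * 2" by simp
  ultimately show False using assms by simp
qed

text \<open>Since \<open>2\<close> is a primitive fourth root of unity, the exponent \<open>(5 ^ n - 1) / 2\<close> of the Euler
  criterion matters modulo \<open>4\<close> only, where it is \<open>0\<close> for even \<open>n\<close> and \<open>2\<close> for odd \<open>n\<close>.\<close>

lemma is_square_2_iff:
  assumes "CARD('a::{field,finite}) = 5 ^ n"
  shows "is_square (2::'a) \<longleftrightarrow> even n"
proof -
  have five: "(5::'a) = 0" using assms by (rule five_eq_0)
  have two: "(2::'a) \<noteq> 0" using five by (rule two_neq_0)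
  have "(2::'a) ^ 4 = 1 + 3 * 5" by simp
  then have pow4: "(2::'a) ^ 4 = 1" using five by simp
  have pow: "(2::'a) ^ (4 * j) = 1" for j
    by (subst power_mult) (simp add: pow4 del: power_numeral)
  have neq: "(2::'a) ^ 2 \<noteq> 1"
  proof
    assume "(2::'a) ^ 2 = 1"
    moreover have "(2::'a) = 5 - (2 ^ 2 - 1)" by simp
    ultimately show False using five two by simp
  qed
  have mod8: "(5::nat) ^ (2 * m) mod 8 = 1" for m
  proof (induction m)
    case (Suc m)
    have "(5::nat) ^ (2 * Suc m) mod 8 = 25 * (5 ^ (2 * m) mod 8) mod 8"
      by (simp add: mod_mult_right_eq)
    with Suc.IH show ?case by simp
  qed simp
  have half: "N mod 8 = 1 \<Longrightarrow> (N - 1) div 2 = 4 * (N div 8)"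
    "N mod 8 = 5 \<Longrightarrow> (N - 1) div 2 = 4 * (N div 8) + 2" for N :: nat
    by presburger+
  have "(2::'a) ^ ((5 ^ n - 1) div 2) = 1 \<longleftrightarrow> even n"
  proof (cases "even n")
    case True
    then obtain m where "n = 2 * m" by blast
    with mod8[of m] have "(5::nat) ^ n mod 8 = 1" by simp
    then have "(2::'a) ^ ((5 ^ n - 1) div 2) = 1"
      by (simp only: half pow)
    with True show ?thesis by simp
  next
    case False
    then obtain m where "n = 2 * m + 1" by (rule oddE)
    then have "(5::nat) ^ n mod 8 = 5 * (5 ^ (2 * m) mod 8) mod 8"
      by (simp add: mod_mult_right_eq)
    then have "(5::nat) ^ n mod 8 = 5"
      by (simp add: mod8)
    then have "(2::'a) ^ ((5 ^ n - 1) div 2) = 2 ^ 2"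
      by (simp only: half pow power_add mult_1_left)
    with False neq show ?thesis by simp
  qed
  then show ?thesis
    using euler_criterion_finite_field[OF two two] assms by simp
qed

section \<open>Trees hanging from periodic points of a self-map\<close>

lemma periodic_step:
  assumes "periodic f y"
  shows "periodic f (f y)"
  using assms by (metis funpow_swap1 periodic_def)

text \<open>A common multiple of the two periods leads from the common image back to both points.\<close>

lemma periodic_step_inj:
  assumes "periodic f y" "periodic f z" "f y = f z"
  shows "y = z"
proof -
  obtain k l where k: "k > 0" "(f ^^ k) y = y" and l: "l > 0" "(f ^^ l) z = z"
    using assms by (auto simp: periodic_def)
  have fixed: "(f ^^ (j * i)) v = v" if "(f ^^ i) v = v" for i j v
    using that by (induction j) (auto simp: funpow_add)
  obtain m where m: "k * l = Suc m"
    using k l by (metis gr0_conv_Suc nat_0_less_mult_iff)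
  have "y = (f ^^ Suc m) y"
    using fixed[of k y l] k m by (simp add: mult.commute del: funpow.simps)
  also have "\<dots> = (f ^^ Suc m) z"
    unfolding funpow_Suc_right by (simp add: assms)
  also have "\<dots> = z"
    using fixed[of l z k] l m by (simp del: funpow.simps)
  finally show ?thesis .
qed

lemma tree_level_0: "tree_level f r 0 = {r}"
  by (auto simp: tree_level_def)

lemma tree_level_Suc:
  "tree_level f r (Suc k) = {y. f y \<in> tree_level f r k \<and> \<not> periodic f y}"
  unfolding tree_level_def
  by (auto simp only: All_less_Suc2 funpow_Suc_right o_apply funpow_0 mem_Collect_eq)

lemma tree_children_eq:
  assumes "z \<in> tree_level f r k"
  shows "tree_children f r k z = {y. f y = z \<and> \<not> periodic f y}"
  using assms by (auto simp: tree_children_def tree_level_Suc)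

lemma not_periodic_tree_level:
  assumes "z \<in> tree_level f r k" "k > 0"
  shows "\<not> periodic f z"
  using assms by (auto simp: tree_level_def)

text \<open>Sets of children lie in fibres of \<open>f\<close>, so those of distinct vertices are disjoint.\<close>

lemma card_tree_level_Suc:
  fixes f :: "'v::finite \<Rightarrow> 'v"
  shows "card (tree_level f r (Suc k)) =
    (\<Sum>z\<in>tree_level f r k. card (tree_children f r k z))"
proof -
  have "tree_level f r (Suc k) = (\<Union>z\<in>tree_level f r k. tree_children f r k z)"
    by (auto simp: tree_level_Suc tree_children_def)
  moreover have "card (\<Union>z\<in>tree_level f r k. tree_children f r k z) =
      (\<Sum>z\<in>tree_level f r k. card (tree_children f r k z))"
    by (rule card_UN_disjoint) (auto simp: tree_children_def)
  ultimately show ?thesis by simp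
qed

lemma tree_arcs_eq:
  "tree_arcs f r = {(y, z). z \<in> tree_verts f r \<and> f y = z \<and> \<not> periodic f y}"
  by (auto simp: tree_arcs_def tree_verts_def tree_children_eq)

text \<open>Arcs start at points that are not periodic, which makes the root a sink, and every other
  vertex \<open>y\<close> has \<open>(y, f y)\<close> as its only outgoing arc. The set of children of a vertex lies
  in its fibre.\<close>

lemma reversed_binary_tree_of_fibres:
  assumes per: "periodic f r"
    and fibres: "\<And>z. finite {y. f y = z} \<and> card {y. f y = z} \<le> 2"
  shows "reversed_binary_tree (tree_verts f r) (tree_arcs f r) r"
proof -
  let ?V = "tree_verts f r" and ?A = "tree_arcs f r"
  have level_cases: "y = r \<or> f y \<in> ?V \<and> \<not> periodic f y" if y: "y \<in> ?V" for y
  proof -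
    obtain k where "y \<in> tree_level f r k"
      using y by (auto simp: tree_verts_def)
    then show ?thesis
      by (cases k) (auto simp: tree_level_0 tree_level_Suc tree_verts_def)
  qed
  have "r \<in> ?V"
    using tree_level_0[of f r] by (auto simp: tree_verts_def)
  moreover have "?A \<subseteq> ?V \<times> ?V"
  proof (clarsimp simp: tree_arcs_eq)
    fix y assume y: "f y \<in> ?V" "\<not> periodic f y"
    then obtain k where "f y \<in> tree_level f r k"
      by (auto simp: tree_verts_def)
    with y have "y \<in> tree_level f r (Suc k)"
      by (simp add: tree_level_Suc)
    then show "y \<in> ?V" unfolding tree_verts_def by blast
  qed
  moreover have "\<forall>z. (r, z) \<notin> ?A"
    using per by (auto simp: tree_arcs_eq)
  moreover have "\<forall>y \<in> ?V - {r}. \<exists>!z. (y, z) \<in> ?A"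
    using level_cases by (auto simp: tree_arcs_eq)
  moreover have "(y, r) \<in> ?A\<^sup>*" if "y \<in> tree_level f r k" for y k
    using that
  proof (induction k arbitrary: y)
    case 0
    then show ?case by (simp add: tree_level_0)
  next
    case (Suc k)
    then have "f y \<in> tree_level f r k" "\<not> periodic f y"
      by (auto simp: tree_level_Suc)
    moreover from this have "(y, f y) \<in> ?A"
      by (auto simp: tree_arcs_eq tree_verts_def)
    ultimately show ?case
      using Suc.IH by (meson converse_rtrancl_into_rtrancl)
  qed
  then have "\<forall>y \<in> ?V. (y, r) \<in> ?A\<^sup>*"
    by (auto simp: tree_verts_def)
  moreover have "finite {y. (y, z) \<in> ?A} \<and> card {y. (y, z) \<in> ?A} \<le> 2" for z
  proof -
    have "{y. (y, z) \<in> ?A} \<subseteq> {y. f y = z}"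
      by (auto simp: tree_arcs_eq)
    then show ?thesis
      using fibres[of z] by (meson card_mono finite_subset le_trans)
  qed
  ultimately show ?thesis
    unfolding reversed_binary_tree_def by blast
qed

lemma binary_tree_levels:
  fixes f :: "'v::finite \<Rightarrow> 'v"
  assumes root: "card (tree_children f r 0 r) = 1"
    and inner: "\<And>k z. 0 < k \<Longrightarrow> k < d \<Longrightarrow> z \<in> tree_level f r k \<Longrightarrow>
      card (tree_children f r k z) = 2"
    and leaf: "\<And>z. z \<in> tree_level f r d \<Longrightarrow> tree_children f r d z = {}"
    and "d > 0"
  shows card_tree_level: "0 < k \<Longrightarrow> k \<le> d \<Longrightarrow> card (tree_level f r k) = 2 ^ (k - 1)"
    and tree_has_depthI: "tree_has_depth f r d"
proof -
  have card_level: "card (tree_level f r (Suc k)) = 2 ^ k" if "Suc k \<le> d" for k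
    using that
  proof (induction k)
    case 0
    then show ?case
      using root by (simp add: card_tree_level_Suc tree_level_0)
  next
    case (Suc k)
    then show ?case
      using inner[of "Suc k"] by (simp add: card_tree_level_Suc[of f r "Suc k"])
  qed
  then show "card (tree_level f r k) = 2 ^ (k - 1)" if "0 < k" "k \<le> d"
    using that by (cases k) auto
  have "card (tree_level f r d) \<noteq> 0"
    using card_level[of "d - 1"] \<open>d > 0\<close> by simp
  then have "tree_level f r d \<noteq> {}" by auto
  moreover have "tree_level f r (Suc d + j) = {}" for j
  proof (induction j)
    case 0
    have "card (tree_level f r (Suc d)) = 0"
      by (simp add: card_tree_level_Suc leaf)
    then show ?case by simp
  next
    case (Suc j)
    then show ?case by (simp add: tree_level_Suc)
  qed
  then have "tree_level f r k = {}" if "k > d" for k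
    using that by (metis le_Suc_ex Suc_leI)
  ultimately show "tree_has_depth f r d"
    unfolding tree_has_depth_def by (meson not_le)
qed

section \<open>Fibres of the map \<open>x + 1 / x\<close>\<close>

lemma theta_eq_Some_iff:
  "theta y = Some z \<longleftrightarrow> (\<exists>t. y = Some t \<and> t \<noteq> 0 \<and> t + inverse t = z)"
  by (cases y) auto

lemma theta_fibre:
  fixes u :: "'a::field"
  assumes "u \<noteq> 0"
  shows "{y. theta y = Some (u + inverse u)} = {Some u, Some (inverse u)}"
proof -
  have "t = u \<or> t = inverse u" if "t \<noteq> 0" "t + inverse t = u + inverse u" for t
  proof -
    have "(t - u) * (t - inverse u) = t * ((t + inverse t) - (u + inverse u))"
      using that(1) assms by (simp add: algebra_simps)
    then have "(t - u) * (t - inverse u) = 0"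
      by (simp add: that(2))
    then show ?thesis by simp
  qed
  moreover have "inverse u + inverse (inverse u) = u + inverse u"
    by (simp add: add.commute)
  ultimately show ?thesis
    using assms unfolding theta_eq_Some_iff by (intro set_eqI iffI) auto
qed

lemma card_theta_fibre:
  fixes z :: "'a::{field,finite} option"
  shows "card {y. theta y = z} \<le> 2"
proof (cases z)
  case None
  have "{y::'a option. theta y = None} = {None, Some 0}"
  proof (intro set_eqI)
    show "y \<in> {y. theta y = None} \<longleftrightarrow> y \<in> {None, Some 0}" for y :: "'a option"
      by (cases y) auto
  qed
  with None show ?thesis by (simp add: card_insert_if)
next
  case (Some w)
  show ?thesis
  proof (cases "{y. theta y = Some w} = {}")
    case True
    with Some show ?thesis by simp
  next
    case False
    then obtain u where "u \<noteq> 0" "u + inverse u = w"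
      by (auto simp: theta_eq_Some_iff)
    with Some theta_fibre[of u] show ?thesis
      by (simp add: card_insert_if)
  qed
qed

lemma square_plus_1_eq:
  fixes z :: "'a::field"
  assumes "(5::'a) = 0"
  shows "z ^ 2 + 1 = (z - 2) * (z + 2)"
proof -
  have "z ^ 2 + 1 = (z - 2) * (z + 2) + 5"
    by (simp add: algebra_simps power2_eq_square)
  with assms show ?thesis by simp
qed

text \<open>If \<open>z = v + 1 / v\<close> then \<open>z\<^sup>2 + 1 = (v - 1 / v)\<^sup>2\<close>, because \<open>5 = 0\<close>. So the product of
  \<open>z\<close> and its image is a square, and \<open>z\<close> cannot be a square when its image is not.\<close>

lemma theta_fibre_empty:
  fixes z :: "'a::field"
  assumes five: "(5::'a) = 0" and z: "is_square z" "\<not> is_square (z + inverse z)"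
  shows "{y. theta y = Some z} = {}"
proof (rule ccontr)
  assume "\<not> ?thesis"
  then obtain v where v: "v \<noteq> 0" "z = v + inverse v"
    by (auto simp: theta_eq_Some_iff)
  have z0: "z \<noteq> 0" using z by auto
  have "z ^ 2 + 1 = (v - inverse v) ^ 2 + 5"
    unfolding v(2) using v(1) by (simp add: algebra_simps power2_eq_square)
  moreover have "z * (z + inverse z) = z ^ 2 + 1"
    using z0 by (simp add: distrib_left power2_eq_square)
  ultimately have "z * (z + inverse z) = (v - inverse v) ^ 2"
    using five by simp
  moreover from this have "v - inverse v \<noteq> 0"
    using z z0 by auto
  ultimately show False
    using z is_square_cong by blast
qed

text \<open>The equation \<open>u\<^sup>2 - z u + 1 = 0\<close> has discriminant \<open>z\<^sup>2 - 4 = z\<^sup>2 + 1\<close>, which is the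
  product of \<open>z\<close> and its image.\<close>

lemma card_theta_fibre_eq_2:
  fixes z :: "'a::{field,finite}"
  assumes five: "(5::'a) = 0" and z: "\<not> is_square z" "\<not> is_square (z + inverse z)"
  shows "card {y. theta y = Some z} = 2"
proof -
  have z0: "z \<noteq> 0" using z by auto
  have "is_square (z * (z + inverse z))"
    using is_square_mult_nonsquares[OF two_neq_0[OF five]] z by blast
  then obtain d where d: "z ^ 2 + 1 = d ^ 2"
    using z0 by (auto simp: is_nth_power_def distrib_left power2_eq_square)
  have d0: "d \<noteq> 0"
  proof
    assume "d = 0"
    with d have "z * (z + inverse z) = 0"
      using z0 by (simp add: distrib_left power2_eq_square)
    with z show False by auto
  qed
  \<comment> \<open>Half of \<open>z + d\<close>: the inverse of \<open>2\<close> is \<open>3\<close>.\<close>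
  define u where "u = 3 * (z + d)"
  have "u * (z - u) - 1 = 6 * (d ^ 2 - (z ^ 2 + 1)) - 5 * (3 * d ^ 2 + 3 * z * d - 1)"
    by (simp add: u_def algebra_simps power2_eq_square)
  then have u: "u * (z - u) = 1"
    using d five by simp
  then have u0: "u \<noteq> 0" and inv: "inverse u = z - u"
    by (auto intro: inverse_unique)
  have "u - (z - u) = 5 * (z + d) + d"
    by (simp add: u_def algebra_simps)
  with five d0 have "u \<noteq> z - u" by auto
  with theta_fibre[OF u0] inv show ?thesis
    by simp
qed

(* From here on the map is handled through its fibres, as described by theta_eq_Some_iff. *)
declare theta.simps(2) [simp del]

section \<open>The points of the cycles\<close>

text \<open>Since \<open>x\<^sup>3 + x = x\<^sup>2 (x + 1 / x)\<close>, a square root \<open>c\<close> of \<open>x + 1 / x\<close> yields the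
  ordinates \<open>x c\<close> and \<open>- x c\<close> in the smaller field, and these are all the ordinates over
  \<open>x\<close>.\<close>

lemma not_is_square_theta_B':
  fixes \<iota> :: "'a::field \<Rightarrow> 'b::field"
  assumes emb: "field_embedding \<iota>" and x: "x \<in> B' \<iota>"
  shows "\<not> is_square (x + inverse x)"
proof
  assume "is_square (x + inverse x)"
  then obtain c where c: "x + inverse x = c ^ 2"
    by (auto elim: is_nth_powerE)
  have add: "\<iota> (a + b) = \<iota> a + \<iota> b" and mult: "\<iota> (a * b) = \<iota> a * \<iota> b" for a b
    using emb by (auto simp: field_embedding_def)
  have zero: "\<iota> 0 = 0"
    using add[of 0 0] by (metis add_0_right add_cancel_right_right)
  have minus: "\<iota> (- a) = - \<iota> a" for a
    using add[of a "- a"] by (simp add: zero eq_neg_iff_add_eq_0 add.commute)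
  obtain y where y: "y \<notin> range \<iota>" "y ^ 2 = \<iota> x ^ 3 + \<iota> x"
    using x by (auto simp: B'_def E_points_def)
  have "x \<noteq> 0"
    using y zero by (metis add_0 power_zero_numeral rangeI zero_eq_power2)
  then have "x * x * x + x = x * x * (x + inverse x)"
    by (simp add: field_simps)
  then have "x * x * x + x = (x * c) * (x * c)"
    by (simp add: c power2_eq_square)
  moreover have "y ^ 2 = \<iota> (x * x * x + x)"
    by (simp add: y(2) add mult power3_eq_cube)
  ultimately have "y ^ 2 = \<iota> (x * c) ^ 2"
    by (simp add: mult[of "x * c"] power2_eq_square[of "\<iota> _"])
  then have "y = \<iota> (x * c) \<or> y = \<iota> (- (x * c))"
    by (simp add: power2_eq_iff minus)
  with y show False by blast
qed

text \<open>The predecessor is reached by following the cycle up to one step before its return.\<close>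

lemma V_B_predecessor:
  assumes "x \<in> V_B n \<iota>"
  obtains p where "p \<in> V_B n \<iota>" "p \<noteq> 0" "p + inverse p = x"
proof -
  have x: "\<And>i. (theta ^^ i) (Some x) \<in> Some ` B n \<iota>" "periodic theta (Some x)"
    using assms by (auto simp: V_B_def)
  then obtain k where k: "(theta ^^ Suc k) (Some x) = Some x"
    by (metis gr0_conv_Suc periodic_def)
  obtain p where p: "(theta ^^ k) (Some x) = Some p"
    using x(1)[of k] by auto
  with k have px: "theta (Some p) = Some x" by simp
  have "(theta ^^ Suc k) (Some p) = Some p"
    using px p by (simp only: funpow_Suc_right o_apply)
  then have "periodic theta (Some p)"
    unfolding periodic_def by blast
  moreover have "(theta ^^ i) (Some p) \<in> Some ` B n \<iota>" for i
    using x(1)[of "i + k"] p by (simp add: funpow_add)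
  ultimately have "p \<in> V_B n \<iota>"
    by (simp add: V_B_def)
  with px show ?thesis
    by (intro that) (auto simp: theta_eq_Some_iff)
qed

lemma not_is_square_theta_V_B:
  assumes "field_embedding \<iota>" "x \<in> V_B n \<iota>"
  shows "\<not> is_square (x + inverse x)"
proof -
  have "(theta ^^ 0) (Some x) \<in> Some ` B n \<iota>"
    using assms(2) unfolding V_B_def by blast
  then have "x \<in> B' \<iota>"
    by (auto simp: B_def split: if_splits)
  with assms(1) show ?thesis by (rule not_is_square_theta_B')
qed

lemma not_is_square_V_B:
  assumes "field_embedding \<iota>" "x \<in> V_B n \<iota>"
  shows "\<not> is_square x"
  using assms by (metis V_B_predecessor not_is_square_theta_V_B)

text \<open>
  On the elliptic curve, adding the point \<open>(2, 0)\<close> of order \<open>2\<close> acts on abscissas by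
  \<open>w \<mapsto> 2 (w + 2) / (w - 2)\<close>, and the endomorphism behind the map sends \<open>(2, 0)\<close> to \<open>(0, 0)\<close>,
  whose addition acts by inversion. This is why the following value is sent to the inverse of
  the image of \<open>w\<close>.
\<close>

definition shift :: "'a::field \<Rightarrow> 'a" where
  "shift w = 2 * (w + 2) / (w - 2)"

context
  fixes w p :: "'a::{field,finite}"
  assumes five: "(5::'a) = 0" and w_p: "w + inverse w = p"
    and w: "\<not> is_square w" and p: "\<not> is_square p"
begin

lemma shift_well_defined: "w \<noteq> 0" "p \<noteq> 0" "w \<noteq> 2" "w \<noteq> - 2" "w ^ 2 + 1 = p * w" "shift w \<noteq> 0"
proof -
  show w0: "w \<noteq> 0" and p0: "p \<noteq> 0"
    using w p by auto
  show *: "w ^ 2 + 1 = p * w"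
    using w0 by (simp add: w_p[symmetric] field_simps power2_eq_square)
  have "(w - 2) * (w + 2) = p * w"
    using square_plus_1_eq[OF five, of w] * by metis
  then have "(w - 2) * (w + 2) \<noteq> 0"
    using w0 p0 by (metis mult_eq_0_iff)
  then show "w \<noteq> 2" "w \<noteq> - 2" "shift w \<noteq> 0"
    using two_neq_0[OF five] by (auto simp only: shift_def divide_eq_0_iff mult_eq_0_iff) auto
qed

lemma shift_plus_inverse: "shift w + inverse (shift w) = inverse p"
proof -
  have w2: "w - 2 \<noteq> 0" "w + 2 \<noteq> 0"
    using shift_well_defined by (auto simp: add_eq_0_iff2)
  have "2 * (w + 2) * (2 * (w + 2)) + (w - 2) * (w - 2) =
      2 * w + 5 * (w ^ 2 + 2 * w + 4)"
    by (simp add: algebra_simps power2_eq_square)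
  then have num: "2 * (w + 2) * (2 * (w + 2)) + (w - 2) * (w - 2) = 2 * w"
    using five by simp
  have "a / b + inverse (a / b) = (a * a + b * b) / (a * b)" if "a \<noteq> 0" "b \<noteq> 0" for a b :: 'a
    using that by (simp add: field_simps)
  from this[of "2 * (w + 2)" "w - 2"] have "shift w + inverse (shift w) =
      (2 * (w + 2) * (2 * (w + 2)) + (w - 2) * (w - 2)) / (2 * ((w - 2) * (w + 2)))"
    using w2 two_neq_0[OF five] by (simp only: shift_def mult_eq_0_iff simp_thms ac_simps)
  also have "\<dots> = w / ((w - 2) * (w + 2))"
    unfolding num by (rule mult_divide_mult_cancel_left[OF two_neq_0[OF five]])
  also have "\<dots> = w / (p * w)"
    using square_plus_1_eq[OF five, of w] shift_well_defined(5) by simp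
  also have "\<dots> = inverse p"
    using shift_well_defined by (simp add: field_simps)
  finally show ?thesis .
qed

text \<open>Since \<open>w\<^sup>2 + 1 = p w\<close> is a product of two nonsquares, the product of the shift with \<open>2\<close>
  is a square.\<close>

lemma is_square_shift_iff: "is_square (shift w) \<longleftrightarrow> is_square (2::'a)"
proof -
  have w2: "w - 2 \<noteq> 0" "w + 2 \<noteq> 0"
    using shift_well_defined by (auto simp: add_eq_0_iff2)
  have "is_square (p * w)"
    using is_square_mult_nonsquares[OF two_neq_0[OF five] p w] .
  then obtain d where d: "(w - 2) * (w + 2) = d ^ 2"
    using square_plus_1_eq[OF five, of w] shift_well_defined(5) by (auto elim: is_nth_powerE)
  then have d0: "d \<noteq> 0" using w2 by auto
  have "shift w * 2 = (2 * d / (w - 2)) ^ 2"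
    using w2 by (simp add: shift_def power_divide power_mult_distrib flip: d)
      (simp add: divide_simps power2_eq_square)
  moreover have "2 * d / (w - 2) \<noteq> 0"
    using d0 w2 two_neq_0[OF five] by auto
  ultimately show ?thesis by (rule is_square_cong)
qed

text \<open>
  If \<open>v + 1 / v = u\<close> then \<open>(v + 1)\<^sup>2 = v (u + 2)\<close>, so the class of \<open>v\<close> is that of \<open>u + 2\<close>. For
  the two values of \<open>u\<close> at hand, \<open>u + 2\<close> has the class of \<open>w (w - 2)\<close> or of \<open>2 (w + 2)\<close>; if
  \<open>w = q + 1 / q\<close> then \<open>w - 2\<close> and \<open>w + 2\<close> are \<open>(q - 1)\<^sup>2 / q\<close> and \<open>(q + 1)\<^sup>2 / q\<close>,
  which have the class of \<open>q\<close>. So \<open>u + 2\<close> has the class of a product of two nonsquares.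
\<close>

lemma is_square_theta_preimage_shift:
  assumes q: "\<not> is_square q" "q + inverse q = w" and two: "\<not> is_square (2::'a)"
    and v: "v \<noteq> 0" "v + inverse v = u" and u: "u = shift w \<or> u = inverse (shift w)"
  shows "is_square v"
proof -
  note nonsq_mult = is_square_mult_nonsquares[OF two_neq_0[OF five]]
  have w2: "w - 2 \<noteq> 0" "w + 2 \<noteq> 0"
    using shift_well_defined by (auto simp: add_eq_0_iff2)
  have q0: "q \<noteq> 0" using q by auto
  have q1: "(w - 2) * q = (q - 1) ^ 2" "(w + 2) * q = (q + 1) ^ 2"
    using q0 by (simp_all add: q(2)[symmetric] field_simps power2_eq_square)
  have "q - 1 \<noteq> 0" "q + 1 \<noteq> 0"
    using q1 w2 q0 by auto
  then have nonsq: "\<not> is_square (w - 2)" "\<not> is_square (w + 2)"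
    using is_square_cong[OF q1(1)] is_square_cong[OF q1(2)] q by auto
  have "is_square (u + 2) \<and> u + 2 \<noteq> 0"
    using u
  proof
    assume u: "u = shift w"
    have "(u + 2) * (w - 2) = 4 * w"
      using w2 by (simp add: u shift_def field_simps)
    then have "((u + 2) * (w - 2)) * w = (2 * w) ^ 2"
      by (simp add: power2_eq_square)
    then have eq: "(u + 2) * (w * (w - 2)) = (2 * w) ^ 2"
      by (simp only: ac_simps)
    moreover have nz: "2 * w \<noteq> 0"
      using two_neq_0[OF five] shift_well_defined by simp
    ultimately have "u + 2 \<noteq> 0"
      by (metis mult_zero_left zero_eq_power2)
    then show ?thesis
      using is_square_cong[OF eq nz] nonsq_mult[OF w nonsq(1)] by blast
  next
    assume u: "u = inverse (shift w)"
    have "2 * (w + 2) \<noteq> 0"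
      using w2 two_neq_0[OF five] by (metis mult_eq_0_iff)
    then have "u * (2 * (w + 2)) = w - 2"
      unfolding u shift_def inverse_divide times_divide_eq_left
      by (rule nonzero_mult_div_cancel_right)
    then have "(u + 2) * (2 * (w + 2)) = (w - 2) + 2 * (2 * (w + 2))"
      by (simp only: distrib_right)
    also have "\<dots> = 5 * (w + 1) + 1"
      by (simp add: algebra_simps)
    finally have "(u + 2) * (2 * (w + 2)) = 5 * (w + 1) + 1" .
    then have eq: "(u + 2) * (2 * (w + 2)) = 1 ^ 2"
      using five by simp
    then have "u + 2 \<noteq> 0"
      by auto
    then show ?thesis
      using is_square_cong[OF eq one_neq_zero] nonsq_mult[OF two nonsq(2)] by blast
  qed
  moreover have eq: "v * (u + 2) = (v + 1) ^ 2"
    using v(1) by (simp add: v(2)[symmetric] field_simps power2_eq_square)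
  moreover have "v + 1 \<noteq> 0"
    using calculation v by auto
  ultimately show ?thesis
    using is_square_cong[OF eq] by simp
qed

end

section \<open>The trees\<close>

theorem lemma2p8:
  fixes n :: nat
    and \<iota> :: "'a::{field,finite} \<Rightarrow> 'b::{field,finite}"
    and x :: 'a
  assumes "n > 0"
    and "CARD('a) = 5 ^ n"
    and "CARD('b) = 5 ^ (2 * n)"
    and "field_embedding \<iota>"
    and "x \<in> V_B n \<iota>"
  shows "tree_arcs theta (Some x) \<subseteq> graph_arcs theta \<and>
    reversed_binary_tree (tree_verts theta (Some x)) (tree_arcs theta (Some x)) (Some x) \<and>
    (\<exists>d. tree_has_depth theta (Some x) d \<and>
         (\<forall>k. 0 < k \<and> k \<le> d \<longrightarrow> card (tree_level theta (Some x) k) = 2 ^ (k - 1)) \<and>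
         card (tree_children theta (Some x) 0 (Some x)) = 1 \<and>
         (\<forall>k z. 0 < k \<and> k < d \<and> z \<in> tree_level theta (Some x) k \<longrightarrow>
                card (tree_children theta (Some x) k z) = 2) \<and>
         (even n \<longrightarrow> d = 2) \<and>
         (odd n \<longrightarrow> d = 3))"
proof -
  let ?level = "tree_level theta (Some x)" and ?children = "tree_children theta (Some x)"
  have five: "(5::'a) = 0"
    using assms(2) by (rule five_eq_0)
  have periodic: "periodic theta (Some z)" if "z \<in> V_B n \<iota>" for z
    using that by (simp add: V_B_def)
  note nonsq = not_is_square_V_B[OF assms(4)] not_is_square_theta_V_B[OF assms(4)]
  obtain p where p: "p \<in> V_B n \<iota>" "p \<noteq> 0" "p + inverse p = x"
    using V_B_predecessor[OF assms(5)] .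
  obtain w where w: "w \<in> V_B n \<iota>" "w \<noteq> 0" "w + inverse w = p"
    using V_B_predecessor[OF p(1)] .
  obtain q where q: "q \<in> V_B n \<iota>" "q \<noteq> 0" "q + inverse q = w"
    using V_B_predecessor[OF w(1)] .
  note shift = five w(3) nonsq(1)[OF w(1)] nonsq(1)[OF p(1)]

  have branch: "card (?children k (Some z)) = 2"
    if "Some z \<in> ?level k" "0 < k" "\<not> is_square z" "\<not> is_square (z + inverse z)" for k z
  proof -
    have "?children k (Some z) = {y. theta y = Some z}"
      using that not_periodic_tree_level[OF that(1,2)]
      by (auto simp: tree_children_eq dest: periodic_step)
    with that show ?thesis
      using card_theta_fibre_eq_2[OF five] by simp
  qed
  have leaf: "?children k (Some z) = {}"
    if "Some z \<in> ?level k" "is_square z" "\<not> is_square (z + inverse z)" for k z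
    using that theta_fibre_empty[OF five] by (auto simp: tree_children_eq)

  \<comment> \<open>The fibre over the root is \<open>p\<close> and \<open>1 / p\<close>, and \<open>p\<close> is its only periodic point.\<close>
  have root: "?children 0 (Some x) = {Some (inverse p)}"
  proof -
    have fibre: "{y. theta y = Some x} = {Some p, Some (inverse p)}"
      using theta_fibre[OF p(2)] p(3) by simp
    have "card {y. theta y = Some x} = 2"
      using card_theta_fibre_eq_2[OF five] nonsq assms(5) by blast
    then have "p \<noteq> inverse p"
      unfolding fibre by auto
    moreover have "theta (Some (inverse p)) = theta (Some p)"
      using p(2) by (simp add: theta.simps add.commute)
    ultimately have "\<not> periodic theta (Some (inverse p))"
      using periodic_step_inj periodic[OF p(1)] by (metis option.inject)
    moreover have "?children 0 (Some x) = {y. theta y = Some x} \<inter> {y. \<not> periodic theta y}"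
      by (auto simp: tree_children_eq tree_level_0)
    ultimately show ?thesis
      using fibre periodic[OF p(1)] by auto
  qed
  have level1: "?level 1 = {Some (inverse p)}"
    using root by (auto simp: tree_level_Suc tree_children_eq tree_level_0)
  have p_inv: "inverse p + inverse (inverse p) = x"
    using p by (simp add: add.commute)
  have level2: "u = shift w \<or> u = inverse (shift w)" "u + inverse u = inverse p"
    "u \<noteq> 0" if "Some u \<in> ?level 2" for u
  proof -
    have "theta (Some u) \<in> ?level 1"
      using that by (simp add: numeral_2_eq_2 tree_level_Suc[of _ _ "Suc 0"])
    then have "theta (Some u) = Some (inverse p)"
      by (simp only: level1 singleton_iff)
    then show "u = shift w \<or> u = inverse (shift w)" "u + inverse u = inverse p" "u \<noteq> 0"
      using theta_fibre[of "shift w"] shift_well_defined(6)[OF shift] shift_plus_inverse[OF shift]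
      by (auto simp: theta_eq_Some_iff)
  qed
  have level2_square: "is_square u \<longleftrightarrow> even n" if "Some u \<in> ?level 2" for u
    using level2(1)[OF that] is_square_shift_iff[OF shift] is_square_2_iff[OF assms(2)] by auto
  have level1_branch: "card (?children 1 z) = 2" if "z \<in> ?level 1" for z
    using that level1 branch[of "inverse p" 1, unfolded p_inv] nonsq(1)[OF p(1)]
      nonsq(1)[OF assms(5)]
    by simp
  have level_Some: "\<exists>u. z = Some u" if "z \<in> ?level k" for k z
  proof -
    have "(theta ^^ k) None = (None :: 'a option)"
      by (induction k) auto
    with that show ?thesis
      by (cases z) (auto simp: tree_level_def)
  qed
  define d where "d = (if even n then 2 else 3::nat)"
  have inner: "card (?children k z) = 2" if k: "0 < k" "k < d" and z: "z \<in> ?level k" for k z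
  proof -
    have "k = 1 \<or> k = 2 \<and> odd n"
      using k by (cases "even n") (simp_all add: d_def, linarith)
    then consider "k = 1" | "k = 2" "odd n"
      by blast
    then show ?thesis
    proof cases
      case 1
      with z level1_branch show ?thesis by simp
    next
      case 2
      obtain u where u: "z = Some u"
        using level_Some z by blast
      with 2 z have "Some u \<in> ?level 2" by simp
      with 2 level2_square level2(2) nonsq(1)[OF p(1)] show ?thesis
        unfolding u 2 by (intro branch) auto
    qed
  qed
  have leaves: "?children d z = {}" if z: "z \<in> ?level d" for z
  proof -
    obtain v where v: "z = Some v"
      using level_Some z by blast
    show ?thesis
    proof (cases "even n")
      case True
      with z v have v2: "Some v \<in> ?level 2" and d: "d = 2"
        by (auto simp: d_def)
      with True show ?thesis
        unfolding v d using level2_square level2(2) nonsq(1)[OF p(1)] by (intro leaf) auto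
    next
      case False
      with z v have v3: "Some v \<in> ?level 3" and d: "d = 3"
        by (auto simp: d_def)
      then have "theta (Some v) \<in> ?level 2"
        by (simp add: numeral_3_eq_3 numeral_2_eq_2 tree_level_Suc[of _ _ "Suc (Suc 0)"])
      then obtain u where u: "Some u \<in> ?level 2" "theta (Some v) = Some u"
        using level_Some by metis
      then have vu: "v \<noteq> 0" "v + inverse v = u"
        by (auto simp: theta_eq_Some_iff)
      have "\<not> is_square (2::'a)"
        using False is_square_2_iff[OF assms(2)] by simp
      then have "is_square v"
        using is_square_theta_preimage_shift[OF shift nonsq(1)[OF q(1)] q(3) _ vu] level2(1)[OF u(1)]
        by blast
      with v3 vu level2_square[OF u(1)] False show ?thesis
        unfolding v d by (intro leaf) auto
    qed
  qed
  have root_card: "card (?children 0 (Some x)) = 1"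
    using root by simp
  have "d > 0" by (simp add: d_def)
  note shape = binary_tree_levels[OF root_card inner leaves this]
  have "tree_arcs theta (Some x) \<subseteq> graph_arcs theta"
    by (auto simp: tree_arcs_eq graph_arcs_def)
  moreover have "reversed_binary_tree (tree_verts theta (Some x)) (tree_arcs theta (Some x)) (Some x)"
    using periodic[OF assms(5)] card_theta_fibre
    by (intro reversed_binary_tree_of_fibres) auto
  moreover have "(even n \<longrightarrow> d = 2) \<and> (odd n \<longrightarrow> d = 3)"
    by (simp add: d_def)
  ultimately show ?thesis
    using shape root_card inner by blast
qed

end
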